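(* Suppose that $f:\mathbb{R}^n\to(-\infty,\infty]$ is a proper closed function that has the KL property at $\bar x\in\mathrm{dom}\,\partial f$ with an exponent of $\alpha\in[\frac12,1)$, and let $\beta>0$. Consider the function $F(x,y):=f(x)+\frac{\beta}{2}\|x-y\|^2$ on $\mathbb{R}^n\times\mathbb{R}^n$. Then $F$ has the KL property at $(\bar x,\bar x)$ with an exponent of $\alpha$.
   Context: Closed means lower semicontinuous; proper means never $-\infty$ and not identically $+\infty$; $\mathrm{dom}\,f=\{x: f(x)<\infty\}$. For a proper function $f$ and $x\in\mathrm{dom}\,f$, the regular subdifferential is $\widehat\partial f(x)=\{v: \liminf_{z\to x,z\ne x}\frac{f(z)-f(x)-\langle v,z-x\rangle}{\|z-x\|}\ge 0\}$ and the (limiting) subdifferential $\partial f(x)$ is the set of $v$ for which there exist $x^t\to x$ with $f(x^t)\to f(x)$ and $v^t\to v$ with $v^t\in\widehat\partial f(x^t)$ for each $t$; $\partial f(x)=\emptyset$ if $x\notin\mathrm{dom}\,f$. $\mathrm{dom}\,\partial f=\{x:\partial f(x)\ne\emptyset\}$. A proper closed function $f$ has the KL property at $\bar x\in\mathrm{dom}\,\partial f$ with an exponent of $\alpha\in[0,1)$ if there exist $c,\epsilon>0$ and $\nu\in(0,\infty]$ such that $\mathrm{dist}(0,\partial f(x))\ge c\,(f(x)-f(\bar x))^\alpha$ whenever $\|x-\bar x\|\le\epsilon$ and $f(\bar x)<f(x)<f(\bar x)+\nu$ (with $\mathrm{dist}(0,\emptyset)=+\infty$). *)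

theory Defs
  imports "HOL-Analysis.Analysis"
begin

definition edom :: "('a \<Rightarrow> ereal) \<Rightarrow> 'a set" where
  "edom f = {x. f x < \<infinity>}"

definition proper_fun :: "('a \<Rightarrow> ereal) \<Rightarrow> bool" where
  "proper_fun f \<longleftrightarrow> (\<forall>x. f x \<noteq> -\<infinity>) \<and> (\<exists>x. f x \<noteq> \<infinity>)"

definition closed_fun :: "('a::topological_space \<Rightarrow> ereal) \<Rightarrow> bool" where
  "closed_fun f \<longleftrightarrow> (\<forall>x. f x \<le> Liminf (at x) f)"

text \<open>The filter \<open>at x\<close> excludes the point \<open>x\<close> itself, as the lower limit over
  \<open>z \<noteq> x\<close> requires. For \<open>x\<close> in the domain of a proper function, \<open>f x\<close> is finite, so no
  indeterminate form occurs in the difference quotient.\<close>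

definition regular_subdiff :: "('a::euclidean_space \<Rightarrow> ereal) \<Rightarrow> 'a \<Rightarrow> 'a set" where
  "regular_subdiff f x =
    (if x \<in> edom f
     then {v. 0 \<le> Liminf (at x)
                   (\<lambda>z. (f z - f x - ereal (v \<bullet> (z - x))) / ereal (norm (z - x)))}
     else {})"

definition limiting_subdiff :: "('a::euclidean_space \<Rightarrow> ereal) \<Rightarrow> 'a \<Rightarrow> 'a set" where
  "limiting_subdiff f x =
    (if x \<in> edom f
     then {v. \<exists>xs vs. xs \<longlonglongrightarrow> x \<and> (\<lambda>t. f (xs t)) \<longlonglongrightarrow> f x \<and> vs \<longlonglongrightarrow> v \<and>
                      (\<forall>t::nat. vs t \<in> regular_subdiff f (xs t))}
     else {})"

definition dom_subdiff :: "('a::euclidean_space \<Rightarrow> ereal) \<Rightarrow> 'a set" where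
  "dom_subdiff f = {x. limiting_subdiff f x \<noteq> {}}"

text \<open>Distance with values in the extended reals, so that the distance to the empty set
  is \<open>\<infinity>\<close>; the library's \<open>infdist\<close> and \<open>setdist\<close> give \<open>0\<close> there.\<close>

definition edist_set :: "'a::metric_space \<Rightarrow> 'a set \<Rightarrow> ereal" where
  "edist_set x S = (INF y\<in>S. ereal (dist x y))"

text \<open>Whenever the guards hold, \<open>f x - f xb\<close> is finite and positive, so taking its real
  value is harmless and \<open>powr\<close> is the ordinary real power (also for \<open>\<alpha> = 0\<close>).\<close>

definition KL_property :: "('a::euclidean_space \<Rightarrow> ereal) \<Rightarrow> 'a \<Rightarrow> real \<Rightarrow> bool" where
  "KL_property f xb \<alpha> \<longleftrightarrow>
     proper_fun f \<and> closed_fun f \<and> xb \<in> dom_subdiff f \<and> 0 \<le> \<alpha> \<and> \<alpha> < 1 \<and>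
     (\<exists>c \<epsilon> :: real. \<exists>\<nu> :: ereal. 0 < c \<and> 0 < \<epsilon> \<and> 0 < \<nu> \<and>
        (\<forall>x. norm (x - xb) \<le> \<epsilon> \<and> f xb < f x \<and> f x < f xb + \<nu> \<longrightarrow>
             ereal (c * real_of_ereal (f x - f xb) powr \<alpha>)
               \<le> edist_set 0 (limiting_subdiff f x)))"

end

theory Submission
  imports Defs
begin

text \<open>The function \<open>F (x, y) = f x + \<beta>/2 * \<parallel>x - y\<parallel>\<^sup>2\<close> adds to \<open>f\<close> a smooth coupling, whose
  gradient at \<open>(x, y)\<close> is \<open>(\<beta> (x - y), - \<beta> (x - y))\<close>. So a limiting subgradient \<open>(u, w)\<close> of \<open>F\<close>
  at \<open>(x, y)\<close> satisfies \<open>w = - \<beta> (x - y)\<close> and \<open>u + w \<in> \<partial>f x\<close>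
  (\<open>limiting_subdiff_coupled\<close>). Its norm \<open>N\<close> therefore controls both ingredients of \<open>F\<close>:
  \<open>\<beta> \<parallel>x - y\<parallel> = \<parallel>w\<parallel> \<le> N\<close> and \<open>dist 0 (\<partial>f x) \<le> \<parallel>u\<parallel> + \<parallel>w\<parallel> \<le> 2 N\<close>.

  The value gap of \<open>F\<close> over \<open>f xb\<close> is at most \<open>a + q\<close>, where \<open>a\<close> is the positive part of
  \<open>f x - f xb\<close> and \<open>q = \<beta>/2 * \<parallel>x - y\<parallel>\<^sup>2\<close>. The KL inequality of \<open>f\<close> bounds \<open>a powr \<alpha>\<close> by a multiple
  of \<open>N\<close>. For \<open>q\<close>, a quadratic, the natural bound is \<open>sqrt q \<le> const * N\<close>; since
  \<open>\<alpha> \<ge> 1/2\<close>, gaps below \<open>1\<close> have an \<open>\<alpha>\<close>-th power that is no larger than their square root, and this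
  is where the restriction on the exponent enters. Adding up the two bounds is the content of
  \<open>powr_gap_le\<close>. That \<open>F\<close> has a subgradient at \<open>(xb, xb)\<close> at all holds because the coupling is
  minimal on the diagonal, so that \<open>(v, 0)\<close> is one for every \<open>v \<in> \<partial>f xb\<close>.\<close>

section \<open>Regular subgradients as approximate supporting slopes\<close>

text \<open>Clearing the denominator turns the lower limit of difference quotients into a family of
  inequalities in which \<open>f z\<close> may be infinite without any undefined arithmetic.\<close>

lemma regular_subdiff_iff:
  fixes f :: "'a::euclidean_space \<Rightarrow> ereal"
  assumes fx: "f x = ereal r"
  shows "v \<in> regular_subdiff f x \<longleftrightarrow>
    (\<forall>e>0. \<forall>\<^sub>F z in at x. ereal (r + v \<bullet> (z - x) - e * norm (z - x)) \<le> f z)"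
proof -
  let ?Q = "\<lambda>z. (f z - f x - ereal (v \<bullet> (z - x))) / ereal (norm (z - x))"
  have quot: "ereal (- e) \<le> ?Q z \<longleftrightarrow> ereal (r + v \<bullet> (z - x) - e * norm (z - x)) \<le> f z"
    if "z \<noteq> x" for z e
    using that by (cases "f z") (auto simp: fx field_simps)
  have "v \<in> regular_subdiff f x \<longleftrightarrow> 0 \<le> Liminf (at x) ?Q"
    by (simp add: regular_subdiff_def edom_def fx)
  also have "\<dots> \<longleftrightarrow> (\<forall>C<0. \<forall>\<^sub>F z in at x. C < ?Q z)"
    by (rule le_Liminf_iff)
  also have "\<dots> \<longleftrightarrow> (\<forall>e>0. \<forall>\<^sub>F z in at x. ereal (- e) \<le> ?Q z)" (is "?L \<longleftrightarrow> ?R")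
  proof
    assume L: ?L
    show ?R
    proof (intro allI impI)
      fix e :: real assume "e > 0"
      then have "ereal (- e) < 0" by simp
      with L have "\<forall>\<^sub>F z in at x. ereal (- e) < ?Q z" by blast
      then show "\<forall>\<^sub>F z in at x. ereal (- e) \<le> ?Q z"
        by (rule eventually_mono) simp
    qed
  next
    assume R: ?R
    show ?L
    proof (intro allI impI)
      fix C :: ereal assume "C < 0"
      then obtain s where s: "C < ereal s" "ereal s < 0"
        using ereal_dense2 by blast
      then have "\<forall>\<^sub>F z in at x. ereal s \<le> ?Q z"
        using R[rule_format, of "- s"] by simp
      then show "\<forall>\<^sub>F z in at x. C < ?Q z"
        by (rule eventually_mono) (use s in order)
    qed
  qed
  also have "\<dots> \<longleftrightarrow> (\<forall>e>0. \<forall>\<^sub>F z in at x. ereal (r + v \<bullet> (z - x) - e * norm (z - x)) \<le> f z)"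
    using quot by (simp add: eventually_at_filter cong: conj_cong)
  finally show ?thesis .
qed

section \<open>Subgradients of the quadratically coupled function\<close>

definition coupled :: "('a::euclidean_space \<Rightarrow> ereal) \<Rightarrow> real \<Rightarrow> 'a \<times> 'a \<Rightarrow> ereal" where
  "coupled f \<beta> = (\<lambda>(x, y). f x + ereal (\<beta> / 2 * (norm (x - y))\<^sup>2))"

lemma coupled_Pair: "coupled f \<beta> (x, y) = f x + ereal (\<beta> / 2 * (norm (x - y))\<^sup>2)"
  by (simp add: coupled_def)

lemma edom_coupled_iff: "(x, y) \<in> edom (coupled f \<beta>) \<longleftrightarrow> x \<in> edom f"
  by (cases "f x") (auto simp: edom_def coupled_Pair)

lemma edom_proper_finite:
  assumes "proper_fun f" "x \<in> edom f"
  obtains r where "f x = ereal r"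
  using assms by (cases "f x") (auto simp: proper_fun_def edom_def)

lemma proper_fun_coupled:
  assumes "proper_fun f"
  shows "proper_fun (coupled f \<beta>)"
proof -
  obtain x where "f x \<noteq> \<infinity>" using assms by (auto simp: proper_fun_def)
  then have "coupled f \<beta> (x, x) \<noteq> \<infinity>" by (simp add: coupled_Pair)
  moreover have "coupled f \<beta> z \<noteq> - \<infinity>" for z
    using assms by (cases z) (simp add: proper_fun_def coupled_Pair)
  ultimately show ?thesis by (auto simp: proper_fun_def)
qed

lemma closed_fun_coupled:
  fixes f :: "'a::euclidean_space \<Rightarrow> ereal"
  assumes cl: "closed_fun f"
  shows "closed_fun (coupled f \<beta>)"
  unfolding closed_fun_def
proof
  fix p :: "'a \<times> 'a"
  let ?q = "\<lambda>z::'a \<times> 'a. \<beta> / 2 * (norm (fst z - snd z))\<^sup>2"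
  have coupled: "coupled f \<beta> z = f (fst z) + ereal (?q z)" for z
    by (simp add: coupled_def case_prod_beta)
  show "coupled f \<beta> p \<le> Liminf (at p) (coupled f \<beta>)"
    unfolding le_Liminf_iff
  proof (intro allI impI)
    fix C assume "C < coupled f \<beta> p"
    then have "C - ereal (?q p) < f (fst p)"
      by (simp add: coupled ereal_minus_less)
    \<comment> \<open>A real level strictly between keeps the sum with the coupling free of infinities.\<close>
    then obtain s where s: "C - ereal (?q p) < ereal s" "ereal s < f (fst p)"
      using ereal_dense2 by blast
    have "\<forall>\<^sub>F x in at (fst p). ereal s < f x"
      using cl s(2) unfolding closed_fun_def le_Liminf_iff by blast
    \<comment> \<open>The projection of a punctured neighbourhood of \<open>p\<close> hits \<open>fst p\<close>, so the inequality is
        needed there as well.\<close>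
    then have "\<forall>\<^sub>F x in nhds (fst p). ereal s < f x"
      unfolding eventually_at_filter by (rule eventually_mono) (use s in auto)
    moreover have "filterlim fst (nhds (fst p)) (at p)"
      by (intro tendsto_intros)
    ultimately have "\<forall>\<^sub>F z in at p. ereal s < f (fst z)"
      by (auto simp: filterlim_iff)
    moreover have "\<forall>\<^sub>F z in at p. C < ereal (s + ?q z)"
    proof (rule order_tendstoD)
      show "((\<lambda>z. ereal (s + ?q z)) \<longlongrightarrow> ereal (s + ?q p)) (at p)"
        by (intro tendsto_intros)
      show "C < ereal (s + ?q p)"
        using s(1) by (simp add: ereal_minus_less)
    qed
    ultimately show "\<forall>\<^sub>F z in at p. C < coupled f \<beta> z"
    proof eventually_elim
      case (elim z)
      note elim(2)
      also have "ereal (s + ?q z) \<le> coupled f \<beta> z"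
        unfolding coupled plus_ereal.simps(1)[symmetric]
        using elim(1) by (intro add_right_mono) simp
      finally show ?case .
    qed
  qed
qed

text \<open>On the diagonal the coupling attains its minimum \<open>0\<close>, so a lower estimate of \<open>f\<close> is one of the
  coupled function.\<close>

lemma regular_subdiff_coupled_diagonal:
  fixes f :: "'a::euclidean_space \<Rightarrow> ereal"
  assumes pr: "proper_fun f" and "0 \<le> \<beta>" and v: "v \<in> regular_subdiff f x"
  shows "(v, 0) \<in> regular_subdiff (coupled f \<beta>) (x, x)"
proof -
  have "x \<in> edom f" using v by (auto simp: regular_subdiff_def split: if_splits)
  with pr obtain r where r: "f x = ereal r" by (rule edom_proper_finite)
  have "\<forall>\<^sub>F z in at (x, x).
      ereal (r + (v, 0) \<bullet> (z - (x, x)) - e * norm (z - (x, x))) \<le> coupled f \<beta> z" if "e > 0" for e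
  proof -
    have "\<forall>\<^sub>F z in at x. ereal (r + v \<bullet> (z - x) - e * norm (z - x)) \<le> f z"
      using v \<open>e > 0\<close> unfolding regular_subdiff_iff[where f = f, OF r] by blast
    then have "\<forall>\<^sub>F z in nhds x. ereal (r + v \<bullet> (z - x) - e * norm (z - x)) \<le> f z"
      unfolding eventually_at_filter by (rule eventually_mono) (use r in auto)
    moreover have "filterlim fst (nhds x) (at (x, x))"
      by (rule tendsto_eq_intros refl | simp)+
    ultimately have "\<forall>\<^sub>F z in at (x, x).
        ereal (r + v \<bullet> (fst z - x) - e * norm (fst z - x)) \<le> f (fst z)"
      by (auto simp: filterlim_iff)
    then show ?thesis
    proof (rule eventually_mono)
      fix z :: "'a \<times> 'a"
      obtain a b where z: "z = (a, b)" by (cases z)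
      assume "ereal (r + v \<bullet> (fst z - x) - e * norm (fst z - x)) \<le> f (fst z)"
      then have low: "ereal (r + v \<bullet> (a - x) - e * norm (a - x)) \<le> f a" by (simp add: z)
      have "e * norm (a - x) \<le> e * norm (z - (x, x))"
        using norm_fst_le[of "a - x" "b - x"] \<open>e > 0\<close> by (simp add: z)
      then have "ereal (r + (v, 0) \<bullet> (z - (x, x)) - e * norm (z - (x, x)))
          \<le> ereal (r + v \<bullet> (a - x) - e * norm (a - x))"
        by (simp add: z)
      also have "\<dots> \<le> f a" by (rule low)
      also have "\<dots> \<le> coupled f \<beta> z"
        using \<open>0 \<le> \<beta>\<close> by (simp add: z coupled_Pair ereal_le_add_self)
      finally show "ereal (r + (v, 0) \<bullet> (z - (x, x)) - e * norm (z - (x, x))) \<le> coupled f \<beta> z" .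
    qed
  qed
  then show ?thesis
    using r by (subst regular_subdiff_iff[where r = r]) (auto simp: coupled_Pair)
qed

lemma dom_subdiff_coupled_diagonal:
  fixes f :: "'a::euclidean_space \<Rightarrow> ereal"
  assumes pr: "proper_fun f" and \<beta>: "0 \<le> \<beta>" and x: "x \<in> dom_subdiff f"
  shows "(x, x) \<in> dom_subdiff (coupled f \<beta>)"
proof -
  from x obtain v where "v \<in> limiting_subdiff f x" by (auto simp: dom_subdiff_def)
  then obtain xs vs where dom: "x \<in> edom f" and s: "xs \<longlonglongrightarrow> x" "(\<lambda>t. f (xs t)) \<longlonglongrightarrow> f x" "vs \<longlonglongrightarrow> v"
    "\<And>t::nat. vs t \<in> regular_subdiff f (xs t)"
    by (auto simp: limiting_subdiff_def split: if_splits)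
  have "(\<lambda>t. (xs t, xs t)) \<longlonglongrightarrow> (x, x)" "(\<lambda>t. (vs t, 0::'a)) \<longlonglongrightarrow> (v, 0)"
    "(\<lambda>t. coupled f \<beta> (xs t, xs t)) \<longlonglongrightarrow> coupled f \<beta> (x, x)"
    using s by (auto intro!: tendsto_intros simp: coupled_Pair)
  moreover have "\<forall>t. (vs t, 0) \<in> regular_subdiff (coupled f \<beta>) (xs t, xs t)"
    using regular_subdiff_coupled_diagonal[OF pr \<beta> s(4)] by blast
  ultimately have "(v, 0) \<in> limiting_subdiff (coupled f \<beta>) (x, x)"
    using dom unfolding limiting_subdiff_def edom_coupled_iff by auto
  then show ?thesis by (auto simp: dom_subdiff_def)
qed

text \<open>Restricting the supporting inequality of the coupled function to a horizontal line through
  \<open>(x, y)\<close> gives a subgradient of \<open>f\<close>, after the gradient of the coupling is subtracted: the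
  remainder \<open>\<beta>/2 * \<parallel>z - x\<parallel>\<^sup>2\<close> is of second order. Restricting it to a vertical line leaves a smooth
  function, which has its gradient as its only regular subgradient.\<close>

lemma regular_subdiff_coupled:
  fixes f :: "'a::euclidean_space \<Rightarrow> ereal"
  assumes pr: "proper_fun f" and uw: "(u, w) \<in> regular_subdiff (coupled f \<beta>) (x, y)"
  shows "u + w \<in> regular_subdiff f x" and "w = - \<beta> *\<^sub>R (x - y)"
proof -
  have "(x, y) \<in> edom (coupled f \<beta>)"
    using uw by (auto simp: regular_subdiff_def split: if_splits)
  then obtain r where r: "f x = ereal r"
    using pr by (auto simp: edom_coupled_iff elim: edom_proper_finite)
  define R where "R = r + \<beta> / 2 * (norm (x - y))\<^sup>2"
  have R: "coupled f \<beta> (x, y) = ereal R" by (simp add: coupled_Pair r R_def)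
  have ev: "\<forall>\<^sub>F z in at (x, y).
      ereal (R + (u, w) \<bullet> (z - (x, y)) - e * norm (z - (x, y))) \<le> coupled f \<beta> z" if "e > 0" for e
    using uw that unfolding regular_subdiff_iff[where f = "coupled f \<beta>", OF R] by blast
  have sq: "(norm (a + b))\<^sup>2 = (norm a)\<^sup>2 + 2 * (a \<bullet> b) + (norm b)\<^sup>2" for a b :: 'a
    by (simp add: power2_norm_eq_inner inner_add_left inner_add_right inner_commute)
  have near: "\<forall>\<^sub>F z in at a. \<bar>\<beta>\<bar> * norm (z - a) < e" if "e > 0" for e :: real and a :: 'a
  proof -
    have "((\<lambda>z. \<bar>\<beta>\<bar> * norm (z - a)) \<longlongrightarrow> 0) (at a)" by (auto intro!: tendsto_eq_intros)
    then show ?thesis using that by (rule order_tendstoD)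
  qed
  show w: "w = - \<beta> *\<^sub>R (x - y)"
  proof (rule ccontr)
    assume ne: "w \<noteq> - \<beta> *\<^sub>R (x - y)"
    define d where "d = w + \<beta> *\<^sub>R (x - y)"
    have d: "norm d > 0" using ne by (auto simp: d_def eq_neg_iff_add_eq_0)
    \<comment> \<open>Moving along \<open>d\<close>, the linear part falls short of the supporting slope at rate \<open>norm d\<close>;
        half of that is more than the error term and the second-order term can make up.\<close>
    have "filterlim (\<lambda>t. (x, y + t *\<^sub>R d)) (at (x, y)) (at_right 0)"
      using d by (auto simp: filterlim_at intro!: tendsto_eq_intros eventually_at_rightI[of 0 1])
    from eventually_compose_filterlim[OF ev this, of "norm d / 2"] d
    have "\<forall>\<^sub>F t in at_right 0. ereal (R + (u, w) \<bullet> ((x, y + t *\<^sub>R d) - (x, y))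
        - norm d / 2 * norm ((x, y + t *\<^sub>R d) - (x, y))) \<le> coupled f \<beta> (x, y + t *\<^sub>R d)"
      by simp
    moreover have "\<forall>\<^sub>F t in at_right (0::real). \<bar>\<beta>\<bar> * t < 1"
    proof -
      have "((\<lambda>t. \<bar>\<beta>\<bar> * t) \<longlongrightarrow> 0) (at_right (0::real))" by (auto intro!: tendsto_eq_intros)
      then show ?thesis by (rule order_tendstoD) simp
    qed
    moreover have "\<forall>\<^sub>F t in at_right (0::real). t > 0" by (rule eventually_at_right_less)
    ultimately have "\<forall>\<^sub>F t in at_right (0::real). False"
    proof eventually_elim
      case (elim t)
      have e0: "x - (y + t *\<^sub>R d) = (x - y) + (- t) *\<^sub>R d" by simp
      have e1: "(norm (x - (y + t *\<^sub>R d)))\<^sup>2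
          = (norm (x - y))\<^sup>2 - 2 * t * ((x - y) \<bullet> d) + t\<^sup>2 * (norm d)\<^sup>2"
        unfolding e0 sq by (simp add: power_mult_distrib)
      have wd: "w \<bullet> d = (norm d)\<^sup>2 - \<beta> * ((x - y) \<bullet> d)"
        by (simp add: d_def power2_norm_eq_inner inner_add_left inner_add_right inner_commute
            algebra_simps)
      have "R + t * (w \<bullet> d) - norm d / 2 * (t * norm d)
          \<le> r + \<beta> / 2 * (norm (x - (y + t *\<^sub>R d)))\<^sup>2"
        using elim(1,3) by (simp add: coupled_Pair r norm_Pair)
      then have "t * (norm d)\<^sup>2 - norm d / 2 * (t * norm d) \<le> \<beta> / 2 * (t\<^sup>2 * (norm d)\<^sup>2)"
        unfolding e1 wd R_def by (simp add: algebra_simps)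
      then have "t * (norm d)\<^sup>2 * 1 \<le> t * (norm d)\<^sup>2 * (\<beta> * t)"
        by (simp add: power2_eq_square algebra_simps)
      moreover have "t * (norm d)\<^sup>2 > 0" using d elim(3) by simp
      ultimately have "1 \<le> \<beta> * t" by (simp only: mult_le_cancel_left_pos)
      also have "\<dots> \<le> \<bar>\<beta>\<bar> * t" using elim(3) by (simp add: mult_right_mono)
      finally show False using elim(2) by simp
    qed
    then show False by simp
  qed
  have "\<forall>\<^sub>F z in at x. ereal (r + (u + w) \<bullet> (z - x) - e * norm (z - x)) \<le> f z" if "e > 0" for e
  proof -
    have "filterlim (\<lambda>z. (z, y)) (at (x, y)) (at x)"
      by (auto simp: filterlim_at eventually_at_filter intro!: tendsto_eq_intros)
    from eventually_compose_filterlim[OF ev this, of "e / 2"] \<open>e > 0\<close>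
    have "\<forall>\<^sub>F z in at x. ereal (R + (u, w) \<bullet> ((z, y) - (x, y))
        - e / 2 * norm ((z, y) - (x, y))) \<le> coupled f \<beta> (z, y)"
      by simp
    with near[OF \<open>e > 0\<close>, of x] show ?thesis
    proof eventually_elim
      case (elim z)
      have "z - y = (x - y) + (z - x)" by simp
      then have e1: "(norm (z - y))\<^sup>2 = (norm (x - y))\<^sup>2 + 2 * ((x - y) \<bullet> (z - x)) + (norm (z - x))\<^sup>2"
        by (metis sq)
      have "\<beta> * (norm (z - x))\<^sup>2 \<le> (\<bar>\<beta>\<bar> * norm (z - x)) * norm (z - x)"
        unfolding power2_eq_square mult.assoc by (intro mult_right_mono) auto
      also have "\<dots> \<le> e * norm (z - x)"
        using elim(1) by (intro mult_right_mono) auto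
      finally have e2: "\<beta> * (norm (z - x))\<^sup>2 \<le> e * norm (z - x)" .
      have e3: "(u + w) \<bullet> (z - x) = u \<bullet> (z - x) - \<beta> * ((x - y) \<bullet> (z - x))"
        by (simp add: w inner_add_left inner_diff_left algebra_simps)
      show ?case
      proof (cases "f z")
        case (real s)
        have "R + u \<bullet> (z - x) - e / 2 * norm (z - x) \<le> s + \<beta> / 2 * (norm (z - y))\<^sup>2"
          using elim(2) by (simp add: coupled_Pair real norm_Pair)
        then have "r + (u + w) \<bullet> (z - x) - e * norm (z - x) \<le> s"
          using e2 unfolding e1 e3 R_def by (simp add: algebra_simps)
        then show ?thesis by (simp add: real)
      qed (use pr in \<open>auto simp: proper_fun_def\<close>)
    qed
  qed
  then show "u + w \<in> regular_subdiff f x" by (simp add: regular_subdiff_iff[where f = f, OF r])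
qed

text \<open>Both properties of regular subgradients are closed conditions. Convergence of the values of
  \<open>f\<close> along the approximating sequence is recovered because the coupling is finite and continuous.\<close>

lemma limiting_subdiff_coupled:
  fixes f :: "'a::euclidean_space \<Rightarrow> ereal"
  assumes pr: "proper_fun f" and uw: "(u, w) \<in> limiting_subdiff (coupled f \<beta>) (x, y)"
  shows "u + w \<in> limiting_subdiff f x" and "w = - \<beta> *\<^sub>R (x - y)"
proof -
  obtain ps qs where dom: "x \<in> edom f" and ps: "ps \<longlonglongrightarrow> (x, y)"
    and val: "(\<lambda>t. coupled f \<beta> (ps t)) \<longlonglongrightarrow> coupled f \<beta> (x, y)"
    and qs: "qs \<longlonglongrightarrow> (u, w)"
    and reg: "\<And>t::nat. qs t \<in> regular_subdiff (coupled f \<beta>) (ps t)"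
    using uw by (auto simp: limiting_subdiff_def edom_coupled_iff split: if_splits)
  define xs ys us ws where "xs t = fst (ps t)" and "ys t = snd (ps t)"
    and "us t = fst (qs t)" and "ws t = snd (qs t)" for t
  have lims: "xs \<longlonglongrightarrow> x" "ys \<longlonglongrightarrow> y" "us \<longlonglongrightarrow> u" "ws \<longlonglongrightarrow> w"
    using tendsto_fst[OF ps] tendsto_snd[OF ps] tendsto_fst[OF qs] tendsto_snd[OF qs]
    unfolding xs_def ys_def us_def ws_def by simp_all
  have reg': "us t + ws t \<in> regular_subdiff f (xs t)" "ws t = - \<beta> *\<^sub>R (xs t - ys t)" for t
    using regular_subdiff_coupled[OF pr, of "us t" "ws t" \<beta> "xs t" "ys t"] reg[of t]
    by (simp_all add: xs_def ys_def us_def ws_def)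
  have "ws \<longlonglongrightarrow> - \<beta> *\<^sub>R (x - y)"
    unfolding reg'(2) by (intro tendsto_intros lims)
  with lims(4) show "w = - \<beta> *\<^sub>R (x - y)" by (rule LIMSEQ_unique)
  obtain r where r: "f x = ereal r" using pr dom by (rule edom_proper_finite)
  let ?q = "\<lambda>a b. ereal (\<beta> / 2 * (norm (a - b))\<^sup>2)"
  have "(\<lambda>t. ?q (xs t) (ys t)) \<longlonglongrightarrow> ?q x y"
    by (intro tendsto_intros lims)
  moreover have "(\<lambda>t. f (xs t) + ?q (xs t) (ys t)) \<longlonglongrightarrow> f x + ?q x y"
    using val by (simp add: coupled_def case_prod_beta xs_def ys_def)
  ultimately have "(\<lambda>t. (f (xs t) + ?q (xs t) (ys t)) - ?q (xs t) (ys t)) \<longlonglongrightarrow> (f x + ?q x y) - ?q x y"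
    by (intro tendsto_diff_ereal) (auto simp: r)
  moreover have "(a + ereal b) - ereal b = a" for a b
    by (cases a) auto
  ultimately have "(\<lambda>t. f (xs t)) \<longlonglongrightarrow> f x" by simp
  then show "u + w \<in> limiting_subdiff f x"
    using dom lims reg' tendsto_add[OF lims(3,4)] unfolding limiting_subdiff_def by auto
qed

section \<open>The Kurdyka-Lojasiewicz inequality\<close>

text \<open>The constant: for \<open>m = max a q\<close> one has \<open>g \<le> 2 m\<close>, and \<open>2 powr \<alpha> \<le> 2\<close>.\<close>

lemma powr_add_le:
  fixes g a q \<alpha> :: real
  assumes "0 \<le> g" "g \<le> a + q" "0 \<le> a" "0 \<le> q" "0 \<le> \<alpha>" "\<alpha> \<le> 1"
  shows "g powr \<alpha> \<le> 2 * (a powr \<alpha> + q powr \<alpha>)"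
proof -
  have "g powr \<alpha> \<le> (2 * max a q) powr \<alpha>"
    using assms by (intro powr_mono2) auto
  also have "\<dots> = 2 powr \<alpha> * max a q powr \<alpha>"
    using assms by (simp add: powr_mult)
  also have "\<dots> \<le> 2 * max a q powr \<alpha>"
    using assms powr_mono[of \<alpha> 1 2] by (intro mult_right_mono) auto
  also have "\<dots> \<le> 2 * (a powr \<alpha> + q powr \<alpha>)"
    by (auto simp: max_def)
  finally show ?thesis .
qed

text \<open>The bound on \<open>q\<close> is needed only up to the size of the gap \<open>g\<close>, so the smallness of \<open>g\<close>
  suffices to pass from \<open>sqrt\<close> to the \<open>\<alpha>\<close>-th power.\<close>

lemma powr_gap_le:
  fixes g a q \<alpha> A B N :: real
  assumes g: "0 < g" "g \<le> 1" "g \<le> a + q" and "0 \<le> a" "0 \<le> q"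
    and \<alpha>: "1 / 2 \<le> \<alpha>" "\<alpha> \<le> 1"
    and a: "a powr \<alpha> \<le> A * N" and q: "sqrt q \<le> B * N"
  shows "g powr \<alpha> \<le> 2 * (A + B) * N"
proof -
  have "g powr \<alpha> \<le> 2 * (a powr \<alpha> + (min q g) powr \<alpha>)"
    using assms by (intro powr_add_le) auto
  also have "(min q g) powr \<alpha> \<le> (min q g) powr (1 / 2)"
    using assms by (cases "q = 0") (auto intro!: powr_mono')
  also have "\<dots> \<le> q powr (1 / 2)"
    using assms by (intro powr_mono2) auto
  also have "\<dots> = sqrt q"
    using assms by (simp add: powr_half_sqrt)
  finally have "g powr \<alpha> \<le> 2 * (a powr \<alpha> + sqrt q)" by simp
  with a q show ?thesis by (simp add: algebra_simps)
qed

lemma KL_property_coupled: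
  fixes f :: "'a::euclidean_space \<Rightarrow> ereal"
  assumes KL: "KL_property f xb \<alpha>" and \<alpha>: "1 / 2 \<le> \<alpha>" and \<beta>: "0 < \<beta>"
  shows "KL_property (coupled f \<beta>) (xb, xb) \<alpha>"
proof -
  from KL obtain c \<epsilon> :: real and \<nu> :: ereal
    where pr: "proper_fun f" and cl: "closed_fun f" and dom: "xb \<in> dom_subdiff f" and \<alpha>1: "\<alpha> < 1"
      and pos: "0 < c" "0 < \<epsilon>" "0 < \<nu>"
      and ineq: "\<And>x. norm (x - xb) \<le> \<epsilon> \<Longrightarrow> f xb < f x \<Longrightarrow> f x < f xb + \<nu> \<Longrightarrow>
             ereal (c * real_of_ereal (f x - f xb) powr \<alpha>) \<le> edist_set 0 (limiting_subdiff f x)"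
    unfolding KL_property_def by blast
  have "xb \<in> edom f" using dom by (auto simp: dom_subdiff_def limiting_subdiff_def split: if_splits)
  with pr obtain rb where rb: "f xb = ereal rb" by (rule edom_proper_finite)
  \<comment> \<open>\<open>2 / c\<close> comes from \<open>c * a powr \<alpha> \<le> 2 N\<close>, the other summand from
      \<open>sqrt (2 \<beta>) * sqrt q = \<beta> \<parallel>x - y\<parallel> \<le> N\<close>. Capping \<open>\<nu>\<close> by \<open>1\<close> keeps the gap below \<open>1\<close>.\<close>
  define K where "K = 2 * (2 / c + 1 / sqrt (2 * \<beta>))"
  have K: "K > 0" using pos \<beta> by (simp add: K_def add_pos_pos)
  have main: "ereal (1 / K * real_of_ereal (coupled f \<beta> p - coupled f \<beta> (xb, xb)) powr \<alpha>)
      \<le> edist_set 0 (limiting_subdiff (coupled f \<beta>) p)"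
    if close: "norm (p - (xb, xb)) \<le> \<epsilon>" and above: "coupled f \<beta> (xb, xb) < coupled f \<beta> p"
      and below: "coupled f \<beta> p < coupled f \<beta> (xb, xb) + min \<nu> 1" for p
    unfolding edist_set_def
  proof (rule INF_greatest)
    fix s assume s: "s \<in> limiting_subdiff (coupled f \<beta>) p"
    obtain x y where p: "p = (x, y)" by (cases p)
    obtain u w where uw: "s = (u, w)" by (cases s)
    note sub = limiting_subdiff_coupled[OF pr s[unfolded p uw]]
    define N where "N = norm s"
    have "x \<in> edom f" using sub(1) by (auto simp: limiting_subdiff_def split: if_splits)
    with pr obtain r where r: "f x = ereal r" by (rule edom_proper_finite)
    define q where "q = \<beta> / 2 * (norm (x - y))\<^sup>2"
    define g where "g = r + q - rb"
    define a where "a = max 0 (r - rb)"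
    have q0: "q \<ge> 0" using \<beta> by (simp add: q_def)
    have Fp: "coupled f \<beta> p = ereal (r + q)" and Fb: "coupled f \<beta> (xb, xb) = ereal rb"
      by (simp_all add: p coupled_Pair r rb q_def)
    have "ereal (r + q) < ereal rb + min \<nu> 1"
      using below by (simp add: Fp Fb)
    also have "\<dots> \<le> ereal rb + 1"
      by (intro add_left_mono) simp
    finally have "ereal (r + q) < ereal rb + 1" .
    then have g: "0 < g" "g \<le> 1" "g \<le> a + q"
      using above unfolding Fp Fb by (auto simp: g_def a_def)
    have wN: "norm w \<le> N" and uN: "norm u \<le> N"
      by (simp_all add: N_def uw norm_fst_le norm_snd_le)
    have "a powr \<alpha> \<le> 2 / c * N"
    proof (cases "rb < r")
      case True
      have "norm (x - xb) \<le> \<epsilon>"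
        using close norm_fst_le[of "x - xb" "y - xb"] by (simp add: p)
      moreover have "f xb < f x" using True by (simp add: r rb)
      moreover have "f x < f xb + \<nu>"
      proof -
        have "f x \<le> ereal (r + q)" using q0 by (simp add: r)
        also have "\<dots> < ereal rb + min \<nu> 1" using below by (simp add: Fp Fb)
        also have "\<dots> \<le> f xb + \<nu>" by (simp add: rb add_left_mono)
        finally show ?thesis .
      qed
      ultimately have "ereal (c * real_of_ereal (f x - f xb) powr \<alpha>)
          \<le> edist_set 0 (limiting_subdiff f x)"
        by (rule ineq)
      also have "\<dots> \<le> ereal (dist 0 (u + w))"
        unfolding edist_set_def using sub(1) by (rule INF_lower)
      finally have "c * a powr \<alpha> \<le> norm (u + w)" using True by (simp add: r rb a_def)
      also have "\<dots> \<le> 2 * N" using norm_triangle_ineq[of u w] wN uN by simp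
      finally show ?thesis using pos by (simp add: field_simps)
    qed (use pos in \<open>simp add: a_def N_def\<close>)
    moreover have "sqrt q \<le> 1 / sqrt (2 * \<beta>) * N"
    proof -
      have "sqrt (2 * \<beta>) * sqrt q = sqrt ((\<beta> * norm (x - y))\<^sup>2)"
        unfolding real_sqrt_mult[symmetric] by (simp add: q_def power2_eq_square algebra_simps)
      also have "\<dots> = norm w" using \<beta> by (simp add: sub(2))
      finally show ?thesis using wN \<beta> by (simp add: field_simps)
    qed
    ultimately have "g powr \<alpha> \<le> K * N"
      unfolding K_def using g q0 \<alpha> \<alpha>1 by (intro powr_gap_le) (auto simp: a_def)
    then have "1 / K * g powr \<alpha> \<le> N" using K by (simp add: field_simps)
    then show "ereal (1 / K * real_of_ereal (coupled f \<beta> p - coupled f \<beta> (xb, xb)) powr \<alpha>)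
        \<le> ereal (dist 0 s)"
      by (simp add: Fp Fb g_def N_def)
  qed
  show ?thesis
    unfolding KL_property_def
  proof (intro conjI)
    show "\<exists>c \<epsilon> :: real. \<exists>\<nu> :: ereal. 0 < c \<and> 0 < \<epsilon> \<and> 0 < \<nu> \<and>
        (\<forall>p. norm (p - (xb, xb)) \<le> \<epsilon> \<and> coupled f \<beta> (xb, xb) < coupled f \<beta> p
              \<and> coupled f \<beta> p < coupled f \<beta> (xb, xb) + \<nu> \<longrightarrow>
           ereal (c * real_of_ereal (coupled f \<beta> p - coupled f \<beta> (xb, xb)) powr \<alpha>)
             \<le> edist_set 0 (limiting_subdiff (coupled f \<beta>) p))"
      using main pos K by (intro exI[of _ "1 / K"] exI[of _ \<epsilon>] exI[of _ "min \<nu> 1"]) auto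
  qed (use \<alpha> \<alpha>1 \<beta> pr cl dom in
      \<open>auto intro: proper_fun_coupled closed_fun_coupled dom_subdiff_coupled_diagonal\<close>)
qed

theorem theorem3p6:
  fixes f :: "real ^ 'n \<Rightarrow> ereal"
    and xb :: "real ^ 'n"
    and \<alpha> \<beta> :: real
    and F :: "(real ^ 'n) \<times> (real ^ 'n) \<Rightarrow> ereal"
  assumes "proper_fun f" and "closed_fun f"
    and "xb \<in> dom_subdiff f"
    and "1 / 2 \<le> \<alpha>" and "\<alpha> < 1"
    and "KL_property f xb \<alpha>"
    and "0 < \<beta>"
    and "\<And>x y. F (x, y) = f x + ereal (\<beta> / 2 * (norm (x - y))\<^sup>2)"
  shows "KL_property F (xb, xb) \<alpha>"
proof -
  have "F = coupled f \<beta>"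
    using assms(8) by (auto simp: fun_eq_iff coupled_Pair)
  then show ?thesis
    using KL_property_coupled assms(4,6,7) by blast
qed

end
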